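(* Let $\kappa$ be a field and $G$ an infinite group having a non-trivial element of finite order. Let $S\subseteq G$ be such that $1\notin S$ and $g^{-1}\in S$ for all $g\in S$, and let $\sigma_S$ be the diagonal factor set generated by $S$. If $|S|<|G|$, then $\Omega_{\sigma_S}$ has no isolated points. Consequently, the spectral partial action $\hat\theta$ of $G$ on $\Omega_{\sigma_S}$ is topologically free.
   Context: The diagonal factor set generated by $S$ is $\sigma_S:G\times G\to\kappa$, $\sigma_S(x,y)=0$ if $\{x,y,xy\}\cap S\neq\varnothing$ and $\sigma_S(x,y)=1$ otherwise (it is a factor set of a partial projective representation of $G$ over $\kappa$). For a factor set $\sigma:G\times G\to\kappa$: let $\Omega=\{\xi\subseteq G:1\in\xi\}$, identified with $\prod_{g\in G\setminus\{1\}}\{0,1\}$ and given the product topology. The $\sigma$-prohibitions of type I are the sets $\{h,hg,hgs\}$ with $h,g,s\in G$ and $\sigma(g,s)=0$; those of type II are the sets $\{h,hg,hgs,hgst\}$ with $h,g,s,t\in G$ and $\sigma(g,st)\sigma(s,t)\neq\sigma(g,s)\sigma(gs,t)$. $\mathcal{P}_\sigma$ is the set of all $\sigma$-prohibitions, and $\Omega_\sigma=\{\xi\in\Omega: V\nsubseteq\xi\text{ for all }V\in\mathcal{P}_\sigma\}$ with the subspace topology. The spectral partial action $\hat\theta$ of $G$ on $\Omega_\sigma$ is given by the clopen sets $\hat D_g=\{\xi\in\Omega_\sigma:g\in\xi\}$ and the homeomorphisms $\hat\theta_g:\hat D_{g^{-1}}\to\hat D_g$, $\hat\theta_g(\xi)=g\xi$.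 A topological partial action $(\{X_g\},\{\theta_g:X_{g^{-1}}\to X_g\})$ of $G$ on a space $X$ is topologically free if for every $g\neq1_G$ the set $\{x\in X_{g^{-1}}:\theta_g(x)=x\}$ has empty interior. *)

theory Defs
  imports "HOL-Analysis.Analysis" "HOL-Algebra.Coset" "HOL-Algebra.Ring"
begin

definition diagonal_factor_set ::
  "('a, 'm) monoid_scheme \<Rightarrow> ('k, 'n) ring_scheme \<Rightarrow> 'a set \<Rightarrow> 'a \<Rightarrow> 'a \<Rightarrow> 'k" where
  "diagonal_factor_set G K S x y =
     (if {x, y, x \<otimes>\<^bsub>G\<^esub> y} \<inter> S \<noteq> {} then \<zero>\<^bsub>K\<^esub> else \<one>\<^bsub>K\<^esub>)"

definition prohibitions_I ::
  "('a, 'm) monoid_scheme \<Rightarrow> ('k, 'n) ring_scheme \<Rightarrow> ('a \<Rightarrow> 'a \<Rightarrow> 'k) \<Rightarrow> 'a set set" where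
  "prohibitions_I G K \<sigma> =
     {{h, h \<otimes>\<^bsub>G\<^esub> g, h \<otimes>\<^bsub>G\<^esub> g \<otimes>\<^bsub>G\<^esub> s} | h g s.
        h \<in> carrier G \<and> g \<in> carrier G \<and> s \<in> carrier G \<and> \<sigma> g s = \<zero>\<^bsub>K\<^esub>}"

definition prohibitions_II ::
  "('a, 'm) monoid_scheme \<Rightarrow> ('k, 'n) ring_scheme \<Rightarrow> ('a \<Rightarrow> 'a \<Rightarrow> 'k) \<Rightarrow> 'a set set" where
  "prohibitions_II G K \<sigma> =
     {{h, h \<otimes>\<^bsub>G\<^esub> g, h \<otimes>\<^bsub>G\<^esub> g \<otimes>\<^bsub>G\<^esub> s, h \<otimes>\<^bsub>G\<^esub> g \<otimes>\<^bsub>G\<^esub> s \<otimes>\<^bsub>G\<^esub> t} | h g s t.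
        h \<in> carrier G \<and> g \<in> carrier G \<and> s \<in> carrier G \<and> t \<in> carrier G \<and>
        \<sigma> g (s \<otimes>\<^bsub>G\<^esub> t) \<otimes>\<^bsub>K\<^esub> \<sigma> s t \<noteq> \<sigma> g s \<otimes>\<^bsub>K\<^esub> \<sigma> (g \<otimes>\<^bsub>G\<^esub> s) t}"

definition prohibitions ::
  "('a, 'm) monoid_scheme \<Rightarrow> ('k, 'n) ring_scheme \<Rightarrow> ('a \<Rightarrow> 'a \<Rightarrow> 'k) \<Rightarrow> 'a set set" where
  "prohibitions G K \<sigma> = prohibitions_I G K \<sigma> \<union> prohibitions_II G K \<sigma>"

definition Omega :: "('a, 'm) monoid_scheme \<Rightarrow> 'a set set" where
  "Omega G = {\<xi>. \<xi> \<subseteq> carrier G \<and> \<one>\<^bsub>G\<^esub> \<in> \<xi>}"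

text \<open>The restricted characteristic function is the bijection identifying \<^term>\<open>Omega G\<close> with the
  product of copies of \<open>{0, 1}\<close> (here: the discrete type \<^typ>\<open>bool\<close>) indexed by the non-identity
  elements of the group; the product topology is transported along it.\<close>

definition Omega_topology :: "('a, 'm) monoid_scheme \<Rightarrow> 'a set topology" where
  "Omega_topology G =
     pullback_topology (Omega G)
       (\<lambda>\<xi>. restrict (\<lambda>g. g \<in> \<xi>) (carrier G - {\<one>\<^bsub>G\<^esub>}))
       (product_topology (\<lambda>_. discrete_topology (UNIV :: bool set)) (carrier G - {\<one>\<^bsub>G\<^esub>}))"

definition Omega_sigma ::
  "('a, 'm) monoid_scheme \<Rightarrow> ('k, 'n) ring_scheme \<Rightarrow> ('a \<Rightarrow> 'a \<Rightarrow> 'k) \<Rightarrow> 'a set set" where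
  "Omega_sigma G K \<sigma> = {\<xi> \<in> Omega G. \<forall>V \<in> prohibitions G K \<sigma>. \<not> V \<subseteq> \<xi>}"

definition Omega_sigma_topology ::
  "('a, 'm) monoid_scheme \<Rightarrow> ('k, 'n) ring_scheme \<Rightarrow> ('a \<Rightarrow> 'a \<Rightarrow> 'k) \<Rightarrow> 'a set topology" where
  "Omega_sigma_topology G K \<sigma> = subtopology (Omega_topology G) (Omega_sigma G K \<sigma>)"

definition isolated_point_of :: "'b topology \<Rightarrow> 'b \<Rightarrow> bool" where
  "isolated_point_of X x \<longleftrightarrow> x \<in> topspace X \<and> openin X {x}"

definition topological_partial_action ::
  "('a, 'm) monoid_scheme \<Rightarrow> 'b topology \<Rightarrow> ('a \<Rightarrow> 'b set) \<Rightarrow> ('a \<Rightarrow> 'b \<Rightarrow> 'b) \<Rightarrow> bool" where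
  "topological_partial_action G X D \<theta> \<longleftrightarrow>
     (\<forall>g \<in> carrier G. openin X (D g)) \<and>
     (\<forall>g \<in> carrier G.
        homeomorphic_map (subtopology X (D (inv\<^bsub>G\<^esub> g))) (subtopology X (D g)) (\<theta> g)) \<and>
     D \<one>\<^bsub>G\<^esub> = topspace X \<and>
     (\<forall>x \<in> topspace X. \<theta> \<one>\<^bsub>G\<^esub> x = x) \<and>
     (\<forall>g \<in> carrier G. \<forall>h \<in> carrier G. \<forall>x \<in> D (inv\<^bsub>G\<^esub> h). \<theta> h x \<in> D (inv\<^bsub>G\<^esub> g) \<longrightarrow>
        x \<in> D (inv\<^bsub>G\<^esub> (g \<otimes>\<^bsub>G\<^esub> h)) \<and> \<theta> (g \<otimes>\<^bsub>G\<^esub> h) x = \<theta> g (\<theta> h x))"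

definition topologically_free ::
  "('a, 'm) monoid_scheme \<Rightarrow> 'b topology \<Rightarrow> ('a \<Rightarrow> 'b set) \<Rightarrow> ('a \<Rightarrow> 'b \<Rightarrow> 'b) \<Rightarrow> bool" where
  "topologically_free G X D \<theta> \<longleftrightarrow>
     topological_partial_action G X D \<theta> \<and>
     (\<forall>g \<in> carrier G. g \<noteq> \<one>\<^bsub>G\<^esub> \<longrightarrow> X interior_of {x \<in> D (inv\<^bsub>G\<^esub> g). \<theta> g x = x} = {})"

definition spectral_domain ::
  "('a, 'm) monoid_scheme \<Rightarrow> ('k, 'n) ring_scheme \<Rightarrow> ('a \<Rightarrow> 'a \<Rightarrow> 'k) \<Rightarrow> 'a \<Rightarrow> 'a set set" where
  "spectral_domain G K \<sigma> g = {\<xi> \<in> Omega_sigma G K \<sigma>. g \<in> \<xi>}"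

definition spectral_map :: "('a, 'm) monoid_scheme \<Rightarrow> 'a \<Rightarrow> 'a set \<Rightarrow> 'a set" where
  "spectral_map G g \<xi> = g <#\<^bsub>G\<^esub> \<xi>"

lemma topspace_Omega_topology [simp]: "topspace (Omega_topology G) = Omega G"
  by (auto simp: Omega_topology_def topspace_pullback_topology)

lemma topspace_Omega_sigma_topology [simp]:
  "topspace (Omega_sigma_topology G K \<sigma>) = Omega_sigma G K \<sigma>"
  by (auto simp: Omega_sigma_topology_def Omega_sigma_def)

lemma continuous_map_Omega_mem:
  assumes "x \<in> carrier G"
  shows "continuous_map (Omega_topology G) (discrete_topology (UNIV :: bool set)) (\<lambda>\<xi>. x \<in> \<xi>)"
proof (cases "x = \<one>\<^bsub>G\<^esub>")
  case True
  have "continuous_map (Omega_topology G) (discrete_topology UNIV) (\<lambda>\<xi>. True)"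
    by simp
  then show ?thesis
    by (rule continuous_map_eq) (simp add: True Omega_def)
next
  case False
  then have x: "x \<in> carrier G - {\<one>\<^bsub>G\<^esub>}" using assms by simp
  show ?thesis
    unfolding Omega_topology_def
    using continuous_map_pullback[OF continuous_map_product_projection[OF x,
        of "\<lambda>_. discrete_topology (UNIV :: bool set)"],
        of "Omega G" "\<lambda>\<xi>. restrict (\<lambda>g. g \<in> \<xi>) (carrier G - {\<one>\<^bsub>G\<^esub>})"] x
    by (simp add: o_def)
qed

lemma (in group) mem_l_coset_iff:
  assumes "g \<in> carrier G" "x \<in> carrier G" "\<xi> \<subseteq> carrier G"
  shows "x \<in> g <# \<xi> \<longleftrightarrow> inv g \<otimes> x \<in> \<xi>"
proof
  assume "x \<in> g <# \<xi>"
  then obtain y where "y \<in> \<xi>" "x = g \<otimes> y" by (auto simp: l_coset_def)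
  with assms show "inv g \<otimes> x \<in> \<xi>" by (auto simp: m_assoc[symmetric] subsetD)
next
  assume "inv g \<otimes> x \<in> \<xi>"
  moreover have "x = g \<otimes> (inv g \<otimes> x)" using assms by (simp add: m_assoc[symmetric])
  ultimately show "x \<in> g <# \<xi>" unfolding l_coset_def by blast
qed

lemma (in group) prohibitions_translate:
  assumes "V \<in> prohibitions G K \<sigma>" "g \<in> carrier G"
  shows "g <# V \<in> prohibitions G K \<sigma>"
proof -
  consider "V \<in> prohibitions_I G K \<sigma>" | "V \<in> prohibitions_II G K \<sigma>"
    using assms(1) by (auto simp: prohibitions_def)
  then show ?thesis
  proof cases
    case 1
    then obtain h a s where V: "V = {h, h \<otimes> a, h \<otimes> a \<otimes> s}" "h \<in> carrier G" "a \<in> carrier G"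
      "s \<in> carrier G" "\<sigma> a s = \<zero>\<^bsub>K\<^esub>" unfolding prohibitions_I_def by blast
    have "g <# V = {g \<otimes> h, g \<otimes> h \<otimes> a, g \<otimes> h \<otimes> a \<otimes> s}"
      using V assms(2) by (auto simp: l_coset_def m_assoc)
    moreover have "g \<otimes> h \<in> carrier G" using V assms(2) by simp
    ultimately have "g <# V \<in> prohibitions_I G K \<sigma>"
      using V unfolding prohibitions_I_def by blast
    then show ?thesis by (simp add: prohibitions_def)
  next
    case 2
    then obtain h a s t where V: "V = {h, h \<otimes> a, h \<otimes> a \<otimes> s, h \<otimes> a \<otimes> s \<otimes> t}" "h \<in> carrier G"
      "a \<in> carrier G" "s \<in> carrier G" "t \<in> carrier G"
      "\<sigma> a (s \<otimes> t) \<otimes>\<^bsub>K\<^esub> \<sigma> s t \<noteq> \<sigma> a s \<otimes>\<^bsub>K\<^esub> \<sigma> (a \<otimes> s) t"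
      unfolding prohibitions_II_def by blast
    have "g <# V = {g \<otimes> h, g \<otimes> h \<otimes> a, g \<otimes> h \<otimes> a \<otimes> s, g \<otimes> h \<otimes> a \<otimes> s \<otimes> t}"
      using V assms(2) by (auto simp: l_coset_def m_assoc)
    moreover have "g \<otimes> h \<in> carrier G" using V assms(2) by simp
    ultimately have "g <# V \<in> prohibitions_II G K \<sigma>"
      using V unfolding prohibitions_II_def by blast
    then show ?thesis by (simp add: prohibitions_def)
  qed
qed

lemma (in group) spectral_map_spectral_domain:
  assumes g: "g \<in> carrier G" and \<xi>: "\<xi> \<in> spectral_domain G K \<sigma> (inv g)"
  shows "spectral_map G g \<xi> \<in> spectral_domain G K \<sigma> g"
    and "spectral_map G (inv g) (spectral_map G g \<xi>) = \<xi>"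
proof -
  have sub: "\<xi> \<subseteq> carrier G" and one: "\<one> \<in> \<xi>" and inv: "inv g \<in> \<xi>"
    and proh: "\<And>V. V \<in> prohibitions G K \<sigma> \<Longrightarrow> \<not> V \<subseteq> \<xi>"
    using \<xi> by (auto simp: spectral_domain_def Omega_sigma_def Omega_def)
  show retract: "spectral_map G (inv g) (spectral_map G g \<xi>) = \<xi>"
    using g sub by (simp add: spectral_map_def lcos_m_assoc lcos_mult_one)
  have "\<not> V \<subseteq> g <# \<xi>" if "V \<in> prohibitions G K \<sigma>" for V
  proof
    assume "V \<subseteq> g <# \<xi>"
    then have "inv g <# V \<subseteq> inv g <# (g <# \<xi>)" by (auto simp: l_coset_def)
    also have "\<dots> = \<xi>" using retract by (simp add: spectral_map_def)
    finally show False using proh prohibitions_translate[OF that] g by blast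
  qed
  moreover have "g <# \<xi> \<subseteq> carrier G" using g sub by (auto simp: l_coset_def)
  moreover have "\<one> \<in> g <# \<xi>" "g \<in> g <# \<xi>"
    using g sub one inv by (simp_all add: mem_l_coset_iff)
  ultimately show "spectral_map G g \<xi> \<in> spectral_domain G K \<sigma> g"
    by (simp add: spectral_map_def spectral_domain_def Omega_sigma_def Omega_def)
qed

lemma (in group) continuous_map_spectral_map:
  assumes g: "g \<in> carrier G"
  shows "continuous_map
           (subtopology (Omega_sigma_topology G K \<sigma>) (spectral_domain G K \<sigma> (inv g)))
           (subtopology (Omega_sigma_topology G K \<sigma>) (spectral_domain G K \<sigma> g))
           (spectral_map G g)"
proof -
  let ?T = "subtopology (Omega_sigma_topology G K \<sigma>) (spectral_domain G K \<sigma> (inv g))"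
  have top: "topspace ?T = spectral_domain G K \<sigma> (inv g)"
    by (auto simp: spectral_domain_def)
  have sub: "\<xi> \<subseteq> carrier G" if "\<xi> \<in> topspace ?T" for \<xi>
    using that unfolding top by (auto simp: spectral_domain_def Omega_sigma_def Omega_def)
  have im: "spectral_map G g \<xi> \<in> spectral_domain G K \<sigma> g" if "\<xi> \<in> topspace ?T" for \<xi>
    using that spectral_map_spectral_domain(1)[OF g] unfolding top by blast
  have "continuous_map ?T (Omega_topology G) (spectral_map G g)"
    unfolding Omega_topology_def
  proof (rule continuous_map_pullback')
    show "topspace ?T \<subseteq> spectral_map G g -` Omega G"
      using im by (auto simp: spectral_domain_def Omega_sigma_def)
    have "continuous_map ?T (discrete_topology UNIV) (\<lambda>\<xi>. x \<in> spectral_map G g \<xi>)"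
      if x: "x \<in> carrier G - {\<one>}" for x
    proof (rule continuous_map_eq)
      show "continuous_map ?T (discrete_topology UNIV) (\<lambda>\<xi>. inv g \<otimes> x \<in> \<xi>)"
        unfolding Omega_sigma_topology_def
        using g x by (intro continuous_map_from_subtopology continuous_map_Omega_mem) auto
    qed (use g x sub in \<open>simp add: spectral_map_def mem_l_coset_iff\<close>)
    then show "continuous_map ?T
        (product_topology (\<lambda>_. discrete_topology (UNIV :: bool set)) (carrier G - {\<one>}))
        ((\<lambda>\<xi>. restrict (\<lambda>g. g \<in> \<xi>) (carrier G - {\<one>})) \<circ> spectral_map G g)"
      by (auto simp: continuous_map_componentwise o_def)
  qed
  then show ?thesis
    using im unfolding Omega_sigma_topology_def
    by (auto simp: continuous_map_in_subtopology Omega_sigma_topology_def spectral_domain_def)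
qed

lemma (in group) topological_partial_action_spectral:
  "topological_partial_action G (Omega_sigma_topology G K \<sigma>)
     (spectral_domain G K \<sigma>) (spectral_map G)"
  unfolding topological_partial_action_def
proof (intro conjI ballI impI)
  let ?X = "Omega_sigma_topology G K \<sigma>"
  fix g assume g: "g \<in> carrier G"
  have "continuous_map ?X (discrete_topology UNIV) (\<lambda>\<xi>. g \<in> \<xi>)"
    unfolding Omega_sigma_topology_def
    by (intro continuous_map_from_subtopology continuous_map_Omega_mem g)
  from openin_continuous_map_preimage[OF this, of "{True}"]
  show "openin ?X (spectral_domain G K \<sigma> g)"
    by (simp add: spectral_domain_def)
  have "homeomorphic_maps
          (subtopology ?X (spectral_domain G K \<sigma> (inv g)))
          (subtopology ?X (spectral_domain G K \<sigma> g))
          (spectral_map G g) (spectral_map G (inv g))"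
    unfolding homeomorphic_maps_def
    using continuous_map_spectral_map[OF g, of K \<sigma>]
      continuous_map_spectral_map[of "inv g" K \<sigma>] g
      spectral_map_spectral_domain(2)[OF g, of _ K \<sigma>]
      spectral_map_spectral_domain(2)[of "inv g" _ K \<sigma>]
    by simp
  then show "homeomorphic_map (subtopology ?X (spectral_domain G K \<sigma> (inv g)))
      (subtopology ?X (spectral_domain G K \<sigma> g)) (spectral_map G g)"
    by (auto simp: homeomorphic_map_maps)
next
  show "spectral_domain G K \<sigma> \<one> = topspace (Omega_sigma_topology G K \<sigma>)"
    by (auto simp: spectral_domain_def Omega_sigma_def Omega_def)
next
  fix \<xi> assume "\<xi> \<in> topspace (Omega_sigma_topology G K \<sigma>)"
  then show "spectral_map G \<one> \<xi> = \<xi>"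
    by (simp add: spectral_map_def Omega_sigma_def Omega_def lcos_mult_one)
next
  fix g h \<xi>
  assume gh: "g \<in> carrier G" "h \<in> carrier G" and \<xi>: "\<xi> \<in> spectral_domain G K \<sigma> (inv h)"
    and h\<xi>: "spectral_map G h \<xi> \<in> spectral_domain G K \<sigma> (inv g)"
  have sub: "\<xi> \<subseteq> carrier G" "\<xi> \<in> Omega_sigma G K \<sigma>"
    using \<xi> by (auto simp: spectral_domain_def Omega_sigma_def Omega_def)
  have "inv g \<in> h <# \<xi>" using h\<xi> by (simp add: spectral_domain_def spectral_map_def)
  then show "\<xi> \<in> spectral_domain G K \<sigma> (inv (g \<otimes> h))"
    using gh sub by (simp add: mem_l_coset_iff inv_mult_group spectral_domain_def)
  show "spectral_map G (g \<otimes> h) \<xi> = spectral_map G g (spectral_map G h \<xi>)"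
    using gh sub by (simp add: spectral_map_def lcos_m_assoc)
qed

end

theory Submission
  imports Defs
begin

text \<open>A point of \<open>\<Omega>\<^sub>\<sigma>\<close> is a set containing the identity no two elements of which differ by an element of
  \<open>S\<close>, i.e. an independent set of the Cayley graph of \<open>S\<close>. A basic open set restricts membership only
  at finitely many elements \<open>F\<close>, so it contains a finite independent set \<open>A\<close>; and since
  \<open>A \<union> F \<union> A S\<close> has smaller cardinality than \<open>G\<close>, it also contains \<open>A \<union> {x}\<close> for some new \<open>x\<close>. Hence
  no point is isolated. If \<open>g \<noteq> 1\<close> fixed both \<open>A\<close> and \<open>A \<union> {x}\<close>, then \<open>g x \<in> A\<close>, so
  \<open>x \<in> A\<close>, a contradiction.\<close>

text \<open>A basic open box of the product constrains only finitely many coordinates;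
  \<open>F\<close> collects those, and membership of all other elements is free.\<close>

lemma Omega_topology_nbhd:
  assumes "openin (Omega_topology G) U" "\<xi> \<in> U"
  obtains F where "finite F"
    "\<And>\<eta>. \<lbrakk>\<eta> \<in> Omega G; \<And>y. y \<in> F \<Longrightarrow> y \<in> \<eta> \<longleftrightarrow> y \<in> \<xi>\<rbrakk> \<Longrightarrow> \<eta> \<in> U"
proof -
  let ?I = "carrier G - {\<one>\<^bsub>G\<^esub>}"
  let ?f = "\<lambda>\<xi>. restrict (\<lambda>g. g \<in> \<xi>) ?I"
  obtain W where W: "openin (product_topology (\<lambda>_. discrete_topology (UNIV :: bool set)) ?I) W"
    and U: "U = ?f -` W \<inter> Omega G"
    using assms(1) unfolding Omega_topology_def openin_pullback_topology by blast
  have "?f \<xi> \<in> W" using assms(2) U by blast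
  then obtain B where B: "finite {i \<in> ?I. B i \<noteq> UNIV}" "?f \<xi> \<in> Pi\<^sub>E ?I B" "Pi\<^sub>E ?I B \<subseteq> W"
    using W unfolding openin_product_topology_alt by (auto 0 3)
  show thesis
  proof (rule that[OF B(1)])
    fix \<eta> assume \<eta>: "\<eta> \<in> Omega G" "\<And>y. y \<in> {i \<in> ?I. B i \<noteq> UNIV} \<Longrightarrow> y \<in> \<eta> \<longleftrightarrow> y \<in> \<xi>"
    have "?f \<eta> i \<in> B i" if "i \<in> ?I" for i
    proof (cases "B i = UNIV")
      case False
      then show ?thesis using \<eta>(2)[of i] PiE_mem[OF B(2) that] that by simp
    qed simp
    then have "?f \<eta> \<in> Pi\<^sub>E ?I B" by (simp add: PiE_iff)
    then show "\<eta> \<in> U" using B(3) U \<eta>(1) by blast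
  qed
qed

text \<open>Any two cardinals are comparable, so by Schroeder-Bernstein both sides negate "B embeds
  into A". This gives \<open>\<prec>\<close> access to the arithmetic of infinite cardinals.\<close>

lemma lesspoll_iff_card_of_ordLess:
  includes cardinal_syntax
  shows "A \<prec> B \<longleftrightarrow> |A| <o |B|"
proof -
  have "A \<lesssim> B \<or> B \<lesssim> A"
    using ordLeq_total[OF card_of_Well_order card_of_Well_order]
    by (auto simp: lepoll_def card_of_ordLeq)
  then have "A \<prec> B \<longleftrightarrow> \<not> B \<lesssim> A"
    by (metis lepoll_antisym eqpoll_imp_lepoll eqpoll_sym lesspoll_def)
  also have "\<dots> \<longleftrightarrow> \<not> |B| \<le>o |A|"
    by (simp add: lepoll_def card_of_ordLeq)
  also have "\<dots> \<longleftrightarrow> |A| <o |B|"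
    by (rule not_ordLeq_iff_ordLess) (rule card_of_Well_order)+
  finally show ?thesis .
qed

lemma Un_lesspoll_infinite:
  assumes "A \<prec> C" "B \<prec> C" "infinite C"
  shows "A \<union> B \<prec> C"
  using assms by (simp add: lesspoll_iff_card_of_ordLess card_of_Un_ordLess_infinite)

lemma finite_UN_lesspoll_infinite:
  assumes "finite I" "\<And>i. i \<in> I \<Longrightarrow> A i \<prec> C" "infinite C"
  shows "(\<Union>i\<in>I. A i) \<prec> C"
  using assms(1,2)
  by induction (simp_all add: finite_lesspoll_infinite Un_lesspoll_infinite assms(3))

text \<open>Each pair \<open>{x, x \<otimes> s}\<close> with \<open>s\<close> in \<open>S\<close> is
  itself a prohibition. Conversely, every prohibition contains two points that differ by an element
  of \<open>S\<close>, so these pairs exclude the same sets.\<close>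

lemma (in group) Omega_sigma_diagonal_factor_set:
  assumes K: "field K" and S: "S \<subseteq> carrier G" "\<one> \<notin> S"
  shows "Omega_sigma G K (diagonal_factor_set G K S) =
    {\<xi> \<in> Omega G. \<forall>x\<in>\<xi>. \<forall>s\<in>S. x \<otimes> s \<notin> \<xi>}"
proof -
  interpret K: field K by (fact K)
  let ?\<sigma> = "diagonal_factor_set G K S"
  have \<sigma>0: "?\<sigma> x y = \<zero>\<^bsub>K\<^esub> \<longleftrightarrow> x \<in> S \<or> y \<in> S \<or> x \<otimes> y \<in> S" for x y
    by (auto simp: diagonal_factor_set_def)
  have \<sigma>1: "?\<sigma> x y = \<one>\<^bsub>K\<^esub>" if "x \<notin> S" "y \<notin> S" "x \<otimes> y \<notin> S" for x y
    using that by (simp add: diagonal_factor_set_def)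
  \<comment> \<open>A degenerate prohibition of type I: for the factors \<open>s\<close> and
    \<open>\<one>\<close> the third point coincides with the second.\<close>
  have pair: "{x, x \<otimes> s} \<in> prohibitions G K ?\<sigma>" if "x \<in> carrier G" "s \<in> S" for x s
  proof -
    have "{x, x \<otimes> s} = {x, x \<otimes> s, x \<otimes> s \<otimes> \<one>}" "?\<sigma> s \<one> = \<zero>\<^bsub>K\<^esub>"
      using that S by (auto simp: \<sigma>0)
    then show ?thesis
      using that S unfolding prohibitions_def prohibitions_I_def by blast
  qed
  have indep: "\<not> V \<subseteq> \<xi>" if V: "V \<in> prohibitions G K ?\<sigma>" and
    \<xi>: "\<And>x s. \<lbrakk>x \<in> \<xi>; s \<in> S\<rbrakk> \<Longrightarrow> x \<otimes> s \<notin> \<xi>" for V \<xi>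
  proof
    assume sub: "V \<subseteq> \<xi>"
    from V consider "V \<in> prohibitions_I G K ?\<sigma>" | "V \<in> prohibitions_II G K ?\<sigma>"
      by (auto simp: prohibitions_def)
    then show False
    proof cases
      case 1
      then obtain h g s where V: "V = {h, h \<otimes> g, h \<otimes> g \<otimes> s}" "h \<in> carrier G"
        "g \<in> carrier G" "s \<in> carrier G" "?\<sigma> g s = \<zero>\<^bsub>K\<^esub>" unfolding prohibitions_I_def by blast
      \<comment> \<open>The value vanishes because \<open>g\<close>, \<open>s\<close> or
        \<open>g \<otimes> s\<close> lies in \<open>S\<close>; these are the differences between the
        three points of \<open>V\<close>.\<close>
      with sub \<xi>[of h g] \<xi>[of "h \<otimes> g" s] \<xi>[of h "g \<otimes> s"] show False
        by (auto simp: \<sigma>0 m_assoc)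
    next
      case 2
      then obtain h g s t where V: "V = {h, h \<otimes> g, h \<otimes> g \<otimes> s, h \<otimes> g \<otimes> s \<otimes> t}" "h \<in> carrier G"
        "g \<in> carrier G" "s \<in> carrier G" "t \<in> carrier G" and
        ne: "?\<sigma> g (s \<otimes> t) \<otimes>\<^bsub>K\<^esub> ?\<sigma> s t \<noteq> ?\<sigma> g s \<otimes>\<^bsub>K\<^esub> ?\<sigma> (g \<otimes> s) t"
        unfolding prohibitions_II_def by blast
      \<comment> \<open>These are the differences of the six pairs among the four points of
        \<open>V\<close>. They cover all arguments and products in the four values of \<sigma>, so
        every value is one and both sides agree.\<close>
      have "g \<notin> S" "s \<notin> S" "t \<notin> S" "g \<otimes> s \<notin> S" "s \<otimes> t \<notin> S" "g \<otimes> s \<otimes> t \<notin> S"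
        using V sub \<xi>[of h g] \<xi>[of "h \<otimes> g" s] \<xi>[of "h \<otimes> g \<otimes> s" t] \<xi>[of h "g \<otimes> s"]
          \<xi>[of "h \<otimes> g" "s \<otimes> t"] \<xi>[of h "g \<otimes> s \<otimes> t"] by (auto simp: m_assoc)
      with ne V show False by (simp add: \<sigma>1 m_assoc)
    qed
  qed
  show ?thesis
  proof (intro Set.set_eqI iffI)
    fix \<xi> assume \<xi>: "\<xi> \<in> Omega_sigma G K ?\<sigma>"
    have "x \<otimes> s \<notin> \<xi>" if "x \<in> \<xi>" "s \<in> S" for x s
    proof
      assume "x \<otimes> s \<in> \<xi>"
      with that(1) have "{x, x \<otimes> s} \<subseteq> \<xi>" by simp
      moreover have "x \<in> carrier G" using \<xi> that(1) by (auto simp: Omega_sigma_def Omega_def)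
      ultimately show False using \<xi> pair that(2) unfolding Omega_sigma_def by blast
    qed
    then show "\<xi> \<in> {\<xi> \<in> Omega G. \<forall>x\<in>\<xi>. \<forall>s\<in>S. x \<otimes> s \<notin> \<xi>}"
      using \<xi> by (auto simp: Omega_sigma_def)
  next
    fix \<xi> assume "\<xi> \<in> {\<xi> \<in> Omega G. \<forall>x\<in>\<xi>. \<forall>s\<in>S. x \<otimes> s \<notin> \<xi>}"
    then show "\<xi> \<in> Omega_sigma G K ?\<sigma>"
      using indep[of _ \<xi>] unfolding Omega_sigma_def by blast
  qed
qed

text \<open>Two points of \<open>U\<close> that differ in a single element serve both claims: one
  takes \<open>U\<close> to be a singleton, the other the interior of a fixed-point set.\<close>

lemma (in group) finite_extension_in_openin_Omega_sigma:
  assumes K: "field K" and inf: "infinite (carrier G)"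
    and S: "S \<subseteq> carrier G" "\<one> \<notin> S" "\<And>g. g \<in> S \<Longrightarrow> inv g \<in> S" "S \<prec> carrier G"
    and U: "openin (Omega_sigma_topology G K (diagonal_factor_set G K S)) U" "\<xi> \<in> U"
  obtains A x where "finite A" "A \<in> U" "x \<in> carrier G" "x \<notin> A" "insert x A \<in> U"
proof -
  note \<Omega>\<sigma> = Omega_sigma_diagonal_factor_set[OF K S(1,2)]
  obtain T where T: "openin (Omega_topology G) T"
    "U = T \<inter> Omega_sigma G K (diagonal_factor_set G K S)"
    using U(1) unfolding Omega_sigma_topology_def openin_subtopology by blast
  then have "\<xi> \<in> T" using U(2) by blast
  then obtain F where F: "finite F"
    "\<And>\<eta>. \<lbrakk>\<eta> \<in> Omega G; \<And>y. y \<in> F \<Longrightarrow> y \<in> \<eta> \<longleftrightarrow> y \<in> \<xi>\<rbrakk> \<Longrightarrow> \<eta> \<in> T"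
    using Omega_topology_nbhd[OF T(1)] by blast
  have \<xi>: "\<xi> \<subseteq> carrier G" "\<one> \<in> \<xi>" "\<And>x s. \<lbrakk>x \<in> \<xi>; s \<in> S\<rbrakk> \<Longrightarrow> x \<otimes> s \<notin> \<xi>"
    using U(2) unfolding T(2) \<Omega>\<sigma> Omega_def by auto
  \<comment> \<open>A subset of \<xi> inherits its independence; this one also agrees with \<xi> on
    \<open>F\<close>. The identity is added because every point must contain it.\<close>
  define A where "A = insert \<one> (\<xi> \<inter> F)"
  have A: "finite A" "A \<subseteq> \<xi>" "\<And>y. y \<in> F \<Longrightarrow> y \<in> A \<longleftrightarrow> y \<in> \<xi>" "\<one> \<in> A"
    using F(1) \<xi>(2) by (auto simp: A_def)
  have "a <# S \<prec> carrier G" for a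
  proof -
    have "a <# S = (\<lambda>s. a \<otimes> s) ` S" by (auto simp: l_coset_def)
    then show ?thesis using S(4) image_lepoll lesspoll_trans1 by metis
  qed
  \<comment> \<open>Everything that \<open>x\<close> has to avoid: \<open>A\<close> to be new,
    \<open>F\<close> to keep the agreement with \<xi>, and the translates of \<open>S\<close> to
    keep independence. A finite union of sets smaller than the infinite group cannot exhaust
    it.\<close>
  then have "(A \<union> F) \<union> (\<Union>a\<in>A. a <# S) \<prec> carrier G"
    using A(1) F(1) inf
    by (intro Un_lesspoll_infinite finite_UN_lesspoll_infinite)
      (simp_all add: finite_lesspoll_infinite)
  then have "\<not> carrier G \<subseteq> (A \<union> F) \<union> (\<Union>a\<in>A. a <# S)"
    using lesspoll_trans1[OF subset_imp_lepoll] by blast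
  then obtain x where x: "x \<in> carrier G" "x \<notin> A" "x \<notin> F" "\<And>a. a \<in> A \<Longrightarrow> x \<notin> a <# S"
    by blast
  \<comment> \<open>Only differences \<open>a\<inverse> x\<close> were excluded by the choice of
    \<open>x\<close>. Closure of \<open>S\<close> under inverses handles the reversed ones, and
    \<open>\<one> \<notin> S\<close> handles \<open>x\<close> against itself.\<close>
  have xA: "x \<otimes> s \<notin> insert x A" if s: "s \<in> S" for s
  proof
    assume "x \<otimes> s \<in> insert x A"
    moreover have "x \<otimes> s \<noteq> x" using s S(1,2) x(1) by auto
    ultimately have "x \<otimes> s \<in> A" by simp
    moreover have "x = (x \<otimes> s) \<otimes> inv s" using s S(1) x(1) by (auto simp: m_assoc)
    ultimately have "x \<in> (x \<otimes> s) <# S" using S(3)[OF s] unfolding l_coset_def by blast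
    with x(4)[OF \<open>x \<otimes> s \<in> A\<close>] show False by simp
  qed
  have Ax: "a \<otimes> s \<notin> insert x A" if "a \<in> A" "s \<in> S" for a s
    using that x(4)[OF that(1)] \<xi>(3) A(2) by (auto simp: l_coset_def)
  have "A \<in> U"
    using A \<xi> Ax F(2)[of A] unfolding T(2) \<Omega>\<sigma> by (auto simp: Omega_def)
  moreover have "insert x A \<in> U"
    using A \<xi> Ax xA x F(2)[of "insert x A"] unfolding T(2) \<Omega>\<sigma> by (auto simp: Omega_def)
  ultimately show thesis using that A(1) x(1,2) by blast
qed

theorem proposition9p6:
  fixes G :: "('a, 'm) monoid_scheme"
    and K :: "('k, 'n) ring_scheme"
    and S :: "'a set"
  assumes "field K"
    and "group G"
    and "infinite (carrier G)"
    and "\<exists>g \<in> carrier G. g \<noteq> \<one>\<^bsub>G\<^esub> \<and> (\<exists>n::nat. n > 0 \<and> g [^]\<^bsub>G\<^esub> n = \<one>\<^bsub>G\<^esub>)"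
    and "S \<subseteq> carrier G"
    and "\<one>\<^bsub>G\<^esub> \<notin> S"
    and "\<forall>g \<in> S. inv\<^bsub>G\<^esub> g \<in> S"
    and "S \<prec> carrier G"
  shows "(\<nexists>\<xi>. isolated_point_of (Omega_sigma_topology G K (diagonal_factor_set G K S)) \<xi>) \<and>
    topologically_free G (Omega_sigma_topology G K (diagonal_factor_set G K S))
      (spectral_domain G K (diagonal_factor_set G K S)) (spectral_map G)"
proof -
  interpret group G by (fact assms(2))
  let ?X = "Omega_sigma_topology G K (diagonal_factor_set G K S)"
  have extend: "\<exists>A x. A \<in> U \<and> x \<in> carrier G \<and> x \<notin> A \<and> insert x A \<in> U"
    if "openin ?X U" "\<xi> \<in> U" for U \<xi>
    using finite_extension_in_openin_Omega_sigma[OF assms(1,3,5,6) _ assms(8) that] assms(7) by metis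
  \<comment> \<open>An open \<open>{\<xi>}\<close> would contain both \<open>A\<close> and the
    strictly larger \<open>insert x A\<close>.\<close>
  have "\<not> isolated_point_of ?X \<xi>" for \<xi>
    using extend[of "{\<xi>}" \<xi>] unfolding isolated_point_of_def by blast
  moreover have "?X interior_of {\<xi> \<in> spectral_domain G K (diagonal_factor_set G K S) (inv\<^bsub>G\<^esub> g).
      spectral_map G g \<xi> = \<xi>} = {}" (is "?X interior_of ?Fix = {}")
    if g: "g \<in> carrier G" "g \<noteq> \<one>\<^bsub>G\<^esub>" for g
  proof (rule ccontr)
    assume "?X interior_of ?Fix \<noteq> {}"
    then obtain \<xi> where "\<xi> \<in> ?X interior_of ?Fix" by blast
    \<comment> \<open>The interior is open, so once nonempty it contains such a pair, and both
      members are fixed by \<open>g\<close>.\<close>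
    then obtain A x where A: "A \<in> ?X interior_of ?Fix" "insert x A \<in> ?X interior_of ?Fix"
      and x: "x \<in> carrier G" "x \<notin> A"
      using extend[OF openin_interior_of] by blast
    have fixed: "A \<subseteq> carrier G" "g <#\<^bsub>G\<^esub> A = A" "g <#\<^bsub>G\<^esub> insert x A = insert x A"
      using A interior_of_subset[of ?X ?Fix]
      by (auto simp: spectral_domain_def Omega_sigma_def Omega_def spectral_map_def)
    \<comment> \<open>Translation by a nontrivial \<open>g\<close> moves \<open>x\<close>, so
      \<open>g\<close> sends it into \<open>A\<close>, which equals its own translate; cancelling
      \<open>g\<close> puts \<open>x\<close> in \<open>A\<close>.\<close>
    have "g \<otimes>\<^bsub>G\<^esub> x \<in> insert x A" using fixed(3) by (auto simp: l_coset_def)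
    moreover have "g \<otimes>\<^bsub>G\<^esub> x \<noteq> x" using g x(1) by (metis r_cancel_one)
    ultimately have "g \<otimes>\<^bsub>G\<^esub> x \<in> g <#\<^bsub>G\<^esub> A" using fixed(2) by simp
    then have "inv\<^bsub>G\<^esub> g \<otimes>\<^bsub>G\<^esub> (g \<otimes>\<^bsub>G\<^esub> x) \<in> A" using g x fixed(1) by (simp add: mem_l_coset_iff)
    with g x show False by (simp add: m_assoc[symmetric])
  qed
  ultimately show ?thesis
    using topological_partial_action_spectral[of K] by (simp add: topologically_free_def)
qed

end
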